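(* Let $G$ be a finite group, $\mathbb{k}$ a field, and let $(\otimes, \mathbb{k}, \alpha', \lambda, \varrho)$ be a monoidal structure on the category of $G$-graded $\mathbb{k}$-vector spaces whose tensor product is $(V \otimes W)_g = \bigoplus_{hk=g} V_h \otimes W_k$, with the usual unitors and a possibly non-standard associator $\alpha'$. Then $$\underline{\mathrm{Hom}}(V,W)_g := \mathrm{Hom}_g(V,W), \qquad g \in G,$$ defines an internal hom for this monoidal category; that is, there are bijections $$\mathrm{Hom}(U \otimes V, W) \cong \mathrm{Hom}(U, \underline{\mathrm{Hom}}(V,W))$$ natural in the $G$-graded vector spaces $U, V, W$.
   Context: A $G$-graded vector space is a direct sum $V = \bigoplus_{g \in G} V_g$ of $\mathbb{k}$-vector spaces; morphisms are linear maps $f$ with $f(V_g) \subseteq W_g$ for all $g \in G$. The monoidal unit $\mathbb{k}$ is the one-dimensional space in degree $1_G$. A linear map $f: V \to W$ between $G$-graded vector spaces is of degree $g$ if $f(V_h) \subseteq W_{gh}$ for all $h \in G$; $\mathrm{Hom}_g(V,W)$ is the vector space of linear maps of degree $g$. *)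

theory Defs
  imports "HOL-Algebra.Module" "HOL-Library.FuncSet" "HOL.Hull"
begin

section \<open>Linear maps and tensor products of vector spaces\<close>

text \<open>A vector space over a field \<open>K\<close> is a \<^locale>\<open>module\<close> over \<open>K\<close>. Maps are normalised to be
  \<^const>\<open>undefined\<close> outside their domain, so that sets of linear maps have the intended equality.\<close>

definition lin ::
  "('k, 'r) ring_scheme \<Rightarrow> ('k, 'a, 'm) module_scheme \<Rightarrow> ('k, 'b, 'n) module_scheme \<Rightarrow> ('a \<Rightarrow> 'b) set"
  where "lin K V W = {f \<in> carrier V \<rightarrow>\<^sub>E carrier W.
    (\<forall>x\<in>carrier V. \<forall>y\<in>carrier V. f (x \<oplus>\<^bsub>V\<^esub> y) = f x \<oplus>\<^bsub>W\<^esub> f y) \<and>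
    (\<forall>a\<in>carrier K. \<forall>x\<in>carrier V. f (a \<odot>\<^bsub>V\<^esub> x) = a \<odot>\<^bsub>W\<^esub> f x)}"

definition bilinear_map ::
  "('k, 'r) ring_scheme \<Rightarrow> ('k, 'a, 'm) module_scheme \<Rightarrow> ('k, 'b, 'n) module_scheme \<Rightarrow>
   ('k, 'c, 'l) module_scheme \<Rightarrow> ('a \<Rightarrow> 'b \<Rightarrow> 'c) \<Rightarrow> bool"
  where "bilinear_map K V W X b \<longleftrightarrow>
    (\<forall>v\<in>carrier V. \<forall>w\<in>carrier W. b v w \<in> carrier X) \<and>
    (\<forall>v\<in>carrier V. \<forall>v'\<in>carrier V. \<forall>w\<in>carrier W. b (v \<oplus>\<^bsub>V\<^esub> v') w = b v w \<oplus>\<^bsub>X\<^esub> b v' w) \<and>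
    (\<forall>v\<in>carrier V. \<forall>w\<in>carrier W. \<forall>w'\<in>carrier W. b v (w \<oplus>\<^bsub>W\<^esub> w') = b v w \<oplus>\<^bsub>X\<^esub> b v w') \<and>
    (\<forall>a\<in>carrier K. \<forall>v\<in>carrier V. \<forall>w\<in>carrier W.
       b (a \<odot>\<^bsub>V\<^esub> v) w = a \<odot>\<^bsub>X\<^esub> b v w \<and> b v (a \<odot>\<^bsub>W\<^esub> w) = a \<odot>\<^bsub>X\<^esub> b v w)"

text \<open>\<open>X\<close> with the bilinear map \<open>t\<close> is a tensor product of \<open>V\<close> and \<open>W\<close>. The test spaces \<open>Y\<close> range
  over the vector spaces on the carrier type of \<open>X\<close>. Whenever that type contains a copy of \<open>K\<close> and
  is large enough for a tensor product of \<open>V\<close> and \<open>W\<close> (in particular if it is infinite and at least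
  as large as \<open>V\<close> and \<open>W\<close>), this is the usual universal property, as the usual tensor product is
  then itself a test space.\<close>

definition is_tensor_product ::
  "('k, 'r) ring_scheme \<Rightarrow> ('k, 'a, 'm) module_scheme \<Rightarrow> ('k, 'b, 'n) module_scheme \<Rightarrow>
   ('k, 'c, 'l) module_scheme \<Rightarrow> ('a \<Rightarrow> 'b \<Rightarrow> 'c) \<Rightarrow> bool"
  where "is_tensor_product K V W X t \<longleftrightarrow>
    module K X \<and> bilinear_map K V W X t \<and>
    (\<forall>(Y :: ('k, 'c) module) b. module K Y \<and> bilinear_map K V W Y b \<longrightarrow>
       (\<exists>!f. f \<in> lin K X Y \<and> (\<forall>v\<in>carrier V. \<forall>w\<in>carrier W. f (t v w) = b v w)))"

definition vspan ::
  "('k, 'r) ring_scheme \<Rightarrow> ('k, 'a, 'm) module_scheme \<Rightarrow> 'a set \<Rightarrow> 'a set"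
  where "vspan K M S = (\<lambda>N. submodule N K M) hull S"

text \<open>\<open>S\<close> is the internal direct sum of the subspaces \<open>X i\<close> of \<open>M\<close>, for a finite index set \<open>I\<close>.\<close>

definition internal_direct_sum ::
  "('k, 'r) ring_scheme \<Rightarrow> ('k, 'a, 'm) module_scheme \<Rightarrow> 'i set \<Rightarrow> ('i \<Rightarrow> 'a set) \<Rightarrow> 'a set \<Rightarrow> bool"
  where "internal_direct_sum K M I X S \<longleftrightarrow>
    finite I \<and> (\<forall>i\<in>I. submodule (X i) K M) \<and>
    bij_betw (\<lambda>x. \<Oplus>\<^bsub>M\<^esub>i\<in>I. x i) (\<Pi>\<^sub>E i\<in>I. X i) S"


section \<open>Graded vector spaces\<close>

record ('k, 'a, 'g) graded = "('k, 'a) module" +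
  component :: "'g \<Rightarrow> 'a set"

definition graded_space ::
  "('g, 'h) monoid_scheme \<Rightarrow> ('k, 'r) ring_scheme \<Rightarrow> ('k, 'a, 'g) graded \<Rightarrow> bool"
  where "graded_space G K V \<longleftrightarrow>
    module K V \<and> internal_direct_sum K V (carrier G) (component V) (carrier V)"

definition hom_deg ::
  "('g, 'h) monoid_scheme \<Rightarrow> ('k, 'r) ring_scheme \<Rightarrow> 'g \<Rightarrow> ('k, 'a, 'g) graded \<Rightarrow>
   ('k, 'b, 'g) graded \<Rightarrow> ('a \<Rightarrow> 'b) set"
  where "hom_deg G K g V W =
    {f \<in> lin K V W. \<forall>h\<in>carrier G. f ` component V h \<subseteq> component W (g \<otimes>\<^bsub>G\<^esub> h)}"

definition ghom ::
  "('g, 'h) monoid_scheme \<Rightarrow> ('k, 'r) ring_scheme \<Rightarrow> ('k, 'a, 'g) graded \<Rightarrow>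
   ('k, 'b, 'g) graded \<Rightarrow> ('a \<Rightarrow> 'b) set"
  where "ghom G K V W = {f \<in> lin K V W. \<forall>g\<in>carrier G. f ` component V g \<subseteq> component W g}"

abbreviation idm :: "('k, 'a, 'g) graded \<Rightarrow> 'a \<Rightarrow> 'a"
  where "idm V \<equiv> (\<lambda>x\<in>carrier V. x)"

definition giso ::
  "('g, 'h) monoid_scheme \<Rightarrow> ('k, 'r) ring_scheme \<Rightarrow> ('k, 'a, 'g) graded \<Rightarrow>
   ('k, 'b, 'g) graded \<Rightarrow> ('a \<Rightarrow> 'b) set"
  where "giso G K V W = {f \<in> ghom G K V W. \<exists>f'\<in>ghom G K W V.
    compose (carrier V) f' f = idm V \<and> compose (carrier W) f f' = idm W}"


section \<open>The graded vector space of linear maps\<close>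

definition lin_space ::
  "('k, 'r) ring_scheme \<Rightarrow> ('k, 'a, 'm) module_scheme \<Rightarrow> ('k, 'b, 'n) module_scheme \<Rightarrow>
   ('k, 'a \<Rightarrow> 'b) module"
  where "lin_space K V W =
    \<lparr>carrier = lin K V W, mult = undefined, one = undefined,
     zero = (\<lambda>v\<in>carrier V. \<zero>\<^bsub>W\<^esub>),
     add = (\<lambda>f f'. \<lambda>v\<in>carrier V. f v \<oplus>\<^bsub>W\<^esub> f' v),
     smult = (\<lambda>a f. \<lambda>v\<in>carrier V. a \<odot>\<^bsub>W\<^esub> f v)\<rparr>"

text \<open>The underlying space is the sum of the subspaces \<^const>\<open>hom_deg\<close> inside the space of all
  linear maps.\<close>

definition ihom ::
  "('g, 'h) monoid_scheme \<Rightarrow> ('k, 'r) ring_scheme \<Rightarrow> ('k, 'a, 'g) graded \<Rightarrow>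
   ('k, 'b, 'g) graded \<Rightarrow> ('k, 'a \<Rightarrow> 'b, 'g) graded"
  where "ihom G K V W =
    \<lparr>carrier = (\<lambda>F. \<Oplus>\<^bsub>lin_space K V W\<^esub>g\<in>carrier G. F g) ` (\<Pi>\<^sub>E g\<in>carrier G. hom_deg G K g V W),
     mult = undefined, one = undefined,
     zero = zero (lin_space K V W),
     add = add (lin_space K V W),
     smult = smult (lin_space K V W),
     component = (\<lambda>g. hom_deg G K g V W)\<rparr>"

text \<open>The action on morphisms \<open>p : V' \<rightarrow> V\<close> and \<open>q : W \<rightarrow> W'\<close>.\<close>

definition ihom_map ::
  "('g, 'h) monoid_scheme \<Rightarrow> ('k, 'r) ring_scheme \<Rightarrow> ('k, 'a, 'g) graded \<Rightarrow>
   ('k, 'b, 'g) graded \<Rightarrow> ('k, 'c, 'g) graded \<Rightarrow> ('c \<Rightarrow> 'a) \<Rightarrow> ('b \<Rightarrow> 'd) \<Rightarrow> ('a \<Rightarrow> 'b) \<Rightarrow> 'c \<Rightarrow> 'd"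
  where "ihom_map G K V W V' p q =
    (\<lambda>f\<in>carrier (ihom G K V W). \<lambda>v\<in>carrier V'. q (f (p v)))"


section \<open>Monoidal structures on graded vector spaces\<close>

text \<open>In the following, \<open>T V W\<close> is the object \<open>V \<otimes> W\<close> and \<open>t V W v w\<close> the pure tensor \<open>v \<otimes> w\<close> in it.
  \<open>J\<close> is the unit object and \<open>\<iota>\<close> its identification with \<open>K\<close>. All objects have carriers in one
  type \<open>'u\<close>, which serves as the universe of the category.\<close>

definition graded_tensor ::
  "('g, 'h) monoid_scheme \<Rightarrow> ('k, 'r) ring_scheme \<Rightarrow> ('k, 'a, 'g) graded \<Rightarrow> ('k, 'b, 'g) graded \<Rightarrow>
   ('k, 'c, 'g) graded \<Rightarrow> ('a \<Rightarrow> 'b \<Rightarrow> 'c) \<Rightarrow> bool"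
  where "graded_tensor G K V W X t \<longleftrightarrow>
    graded_space G K X \<and> is_tensor_product K V W X t \<and>
    (\<forall>g\<in>carrier G. internal_direct_sum K X
       {(h, k). h \<in> carrier G \<and> k \<in> carrier G \<and> h \<otimes>\<^bsub>G\<^esub> k = g}
       (\<lambda>(h, k). vspan K X {t v w | v w. v \<in> component V h \<and> w \<in> component W k})
       (component X g))"

definition graded_unit ::
  "('g, 'h) monoid_scheme \<Rightarrow> ('k, 'r) ring_scheme \<Rightarrow> ('k, 'a, 'g) graded \<Rightarrow> ('k \<Rightarrow> 'a) \<Rightarrow> bool"
  where "graded_unit G K J \<iota> \<longleftrightarrow>
    graded_space G K J \<and> bij_betw \<iota> (carrier K) (carrier J) \<and>
    (\<forall>a\<in>carrier K. \<forall>b\<in>carrier K.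
       \<iota> (a \<oplus>\<^bsub>K\<^esub> b) = \<iota> a \<oplus>\<^bsub>J\<^esub> \<iota> b \<and> \<iota> (a \<otimes>\<^bsub>K\<^esub> b) = a \<odot>\<^bsub>J\<^esub> \<iota> b) \<and>
    (\<forall>g\<in>carrier G. component J g = (if g = \<one>\<^bsub>G\<^esub> then carrier J else {\<zero>\<^bsub>J\<^esub>}))"

definition tensor_map ::
  "('k, 'r) ring_scheme \<Rightarrow>
   (('k, 'u, 'g) graded \<Rightarrow> ('k, 'u, 'g) graded \<Rightarrow> ('k, 'u, 'g) graded) \<Rightarrow>
   (('k, 'u, 'g) graded \<Rightarrow> ('k, 'u, 'g) graded \<Rightarrow> 'u \<Rightarrow> 'u \<Rightarrow> 'u) \<Rightarrow>
   ('k, 'u, 'g) graded \<Rightarrow> ('k, 'u, 'g) graded \<Rightarrow> ('k, 'u, 'g) graded \<Rightarrow> ('k, 'u, 'g) graded \<Rightarrow>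
   ('u \<Rightarrow> 'u) \<Rightarrow> ('u \<Rightarrow> 'u) \<Rightarrow> 'u \<Rightarrow> 'u"
  where "tensor_map K T t V W V' W' p q =
    (THE f. f \<in> lin K (T V W) (T V' W') \<and>
      (\<forall>v\<in>carrier V. \<forall>w\<in>carrier W. f (t V W v w) = t V' W' (p v) (q w)))"

definition left_unitor ::
  "('k, 'r) ring_scheme \<Rightarrow>
   (('k, 'u, 'g) graded \<Rightarrow> ('k, 'u, 'g) graded \<Rightarrow> ('k, 'u, 'g) graded) \<Rightarrow>
   (('k, 'u, 'g) graded \<Rightarrow> ('k, 'u, 'g) graded \<Rightarrow> 'u \<Rightarrow> 'u \<Rightarrow> 'u) \<Rightarrow>
   ('k, 'u, 'g) graded \<Rightarrow> ('k \<Rightarrow> 'u) \<Rightarrow> ('k, 'u, 'g) graded \<Rightarrow> 'u \<Rightarrow> 'u"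
  where "left_unitor K T t J \<iota> V =
    (THE f. f \<in> lin K (T J V) V \<and>
      (\<forall>a\<in>carrier K. \<forall>v\<in>carrier V. f (t J V (\<iota> a) v) = a \<odot>\<^bsub>V\<^esub> v))"

definition right_unitor ::
  "('k, 'r) ring_scheme \<Rightarrow>
   (('k, 'u, 'g) graded \<Rightarrow> ('k, 'u, 'g) graded \<Rightarrow> ('k, 'u, 'g) graded) \<Rightarrow>
   (('k, 'u, 'g) graded \<Rightarrow> ('k, 'u, 'g) graded \<Rightarrow> 'u \<Rightarrow> 'u \<Rightarrow> 'u) \<Rightarrow>
   ('k, 'u, 'g) graded \<Rightarrow> ('k \<Rightarrow> 'u) \<Rightarrow> ('k, 'u, 'g) graded \<Rightarrow> 'u \<Rightarrow> 'u"
  where "right_unitor K T t J \<iota> V =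
    (THE f. f \<in> lin K (T V J) V \<and>
      (\<forall>a\<in>carrier K. \<forall>v\<in>carrier V. f (t V J v (\<iota> a)) = a \<odot>\<^bsub>V\<^esub> v))"

text \<open>The associator \<open>\<alpha> U V W : (U \<otimes> V) \<otimes> W \<rightarrow> U \<otimes> (V \<otimes> W)\<close> is an arbitrary natural isomorphism
  subject to the pentagon and triangle axioms. Bifunctoriality of the tensor product, and
  naturality and invertibility of the unitors, are consequences of their definitions.\<close>

locale graded_monoidal_category =
  fixes G :: "('g, 'h) monoid_scheme"
    and K :: "('k, 'r) ring_scheme"
    and T :: "('k, 'u, 'g) graded \<Rightarrow> ('k, 'u, 'g) graded \<Rightarrow> ('k, 'u, 'g) graded"
    and t :: "('k, 'u, 'g) graded \<Rightarrow> ('k, 'u, 'g) graded \<Rightarrow> 'u \<Rightarrow> 'u \<Rightarrow> 'u"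
    and J :: "('k, 'u, 'g) graded"
    and \<iota> :: "'k \<Rightarrow> 'u"
    and \<alpha> :: "('k, 'u, 'g) graded \<Rightarrow> ('k, 'u, 'g) graded \<Rightarrow> ('k, 'u, 'g) graded \<Rightarrow> 'u \<Rightarrow> 'u"
  assumes tensor:
      "\<lbrakk>graded_space G K V; graded_space G K W\<rbrakk> \<Longrightarrow> graded_tensor G K V W (T V W) (t V W)"
    and unit: "graded_unit G K J \<iota>"
    and assoc_iso:
      "\<lbrakk>graded_space G K U; graded_space G K V; graded_space G K W\<rbrakk> \<Longrightarrow>
        \<alpha> U V W \<in> giso G K (T (T U V) W) (T U (T V W))"
    and assoc_natural:
      "\<lbrakk>graded_space G K U; graded_space G K V; graded_space G K W;
        graded_space G K U'; graded_space G K V'; graded_space G K W';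
        p \<in> ghom G K U U'; q \<in> ghom G K V V'; r \<in> ghom G K W W'\<rbrakk> \<Longrightarrow>
        compose (carrier (T (T U V) W))
          (tensor_map K T t U (T V W) U' (T V' W') p (tensor_map K T t V W V' W' q r)) (\<alpha> U V W) =
        compose (carrier (T (T U V) W))
          (\<alpha> U' V' W') (tensor_map K T t (T U V) W (T U' V') W' (tensor_map K T t U V U' V' p q) r)"
    and pentagon:
      "\<lbrakk>graded_space G K U; graded_space G K V; graded_space G K W; graded_space G K X\<rbrakk> \<Longrightarrow>
        compose (carrier (T (T (T U V) W) X)) (\<alpha> U V (T W X)) (\<alpha> (T U V) W X) =
        compose (carrier (T (T (T U V) W) X))
          (tensor_map K T t U (T (T V W) X) U (T V (T W X)) (idm U) (\<alpha> V W X))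
          (compose (carrier (T (T (T U V) W) X))
            (\<alpha> U (T V W) X)
            (tensor_map K T t (T (T U V) W) X (T U (T V W)) X (\<alpha> U V W) (idm X)))"
    and triangle:
      "\<lbrakk>graded_space G K U; graded_space G K V\<rbrakk> \<Longrightarrow>
        compose (carrier (T (T U J) V))
          (tensor_map K T t U (T J V) U V (idm U) (left_unitor K T t J \<iota> V)) (\<alpha> U J V) =
        tensor_map K T t (T U J) V U V (right_unitor K T t J \<iota> U) (idm V)"

end

theory Submission
  imports Defs
begin

text \<open>The adjunction is currying: \<open>f : U \<otimes> V \<rightarrow> W\<close> corresponds to \<open>u \<mapsto> (v \<mapsto> f (u \<otimes> v))\<close>. For \<open>u\<close> of
  degree \<open>g\<close> this sends \<open>V\<^sub>h\<close> to \<open>W\<^bsub>gh\<^esub>\<close>, so it has degree \<open>g\<close>; conversely, the linear map induced by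
  a bilinear map \<open>(u, v) \<mapsto> \<psi> u v\<close> is graded because each summand \<open>U\<^sub>h \<otimes> V\<^sub>k\<close> is spanned by pure tensors.\<close>

section \<open>Modules and linear maps\<close>

text \<open>The tensor product is known only through its universal property, whose test spaces live
  on its own carrier type. The proof therefore uses it with \<open>W\<close> as test space, and with
  another tensor product where morphisms act on both factors. The second burden is membership:
  \<open>ihom\<close> consists of the sums of homogeneous maps inside
  \<open>lin_space K V W\<close>, so for a map into it both linearity and the shape of its values
  have to be checked. Finally, \<open>ihom\<close> has carrier type
  \<open>'u \<Rightarrow> 'u\<close> and is not literally an object of the category on
  \<open>'u\<close>; the bijection is therefore also transported to every object \<open>H\<close>
  isomorphic to it.\<close>

text \<open>Negation is multiplication by the scalar \<ominus>1, so closure under it comes for free.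
  Unfolding this turns subspace goals into closure conditions that automation handles.\<close>

lemma submodule_iff:
  assumes "module K M"
  shows "submodule H K M \<longleftrightarrow> H \<subseteq> carrier M \<and> \<zero>\<^bsub>M\<^esub> \<in> H \<and>
    (\<forall>x\<in>H. \<forall>y\<in>H. x \<oplus>\<^bsub>M\<^esub> y \<in> H) \<and> (\<forall>a\<in>carrier K. \<forall>x\<in>H. a \<odot>\<^bsub>M\<^esub> x \<in> H)"
    (is "_ \<longleftrightarrow> ?R")
proof
  interpret module K M by fact
  assume H: "submodule H K M"
  have "\<zero>\<^bsub>M\<^esub> \<in> H"
    using subgroup.one_closed[OF submodule.axioms(1)[OF H]] by simp
  then show ?R using submoduleE[OF H] by auto
next
  interpret module K M by fact
  assume R: ?R
  show "submodule H K M"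
  proof (rule submoduleI)
    fix x assume x: "x \<in> H"
    then have "\<ominus>\<^bsub>M\<^esub> x = (\<ominus>\<^bsub>K\<^esub> \<one>\<^bsub>K\<^esub>) \<odot>\<^bsub>M\<^esub> x"
      using R by (subst smult_l_minus) auto
    then show "\<ominus>\<^bsub>M\<^esub> x \<in> H" using R x by auto
  qed (use R in auto)
qed

lemma submodule_finsum:
  assumes M: "module K M" and H: "submodule H K M" and x: "x \<in> A \<rightarrow> H"
  shows "(\<Oplus>\<^bsub>M\<^esub>i\<in>A. x i) \<in> H"
proof -
  interpret module K M by fact
  note H = H[unfolded submodule_iff[OF M]]
  \<comment> \<open>No finiteness of \<open>A\<close> is assumed: over an infinite set the sum is
    \<zero> by convention, and \<zero> lies in \<open>H\<close>.\<close>
  from x show ?thesis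
  proof (induction A rule: infinite_finite_induct)
    case (insert i A)
    then have "x i \<in> carrier M" "x \<in> A \<rightarrow> carrier M" using H by auto
    then show ?case using insert H by auto
  qed (use H in auto)
qed

text \<open>Families are added and scaled termwise. For the family of \<open>hom_deg\<close> spaces
  the image is, by definition, the carrier of \<open>ihom\<close>.\<close>

lemma submodule_sum_image:
  assumes M: "module K M" and X: "\<And>i. i \<in> I \<Longrightarrow> submodule (X i) K M" and "finite I"
  shows "submodule ((\<lambda>x. \<Oplus>\<^bsub>M\<^esub>i\<in>I. x i) ` (\<Pi>\<^sub>E i\<in>I. X i)) K M" (is "submodule ?S K M")
proof -
  interpret module K M by fact
  note X = X[unfolded submodule_iff[OF M]]
  have carr: "x \<in> I \<rightarrow> carrier M" if "x \<in> (\<Pi>\<^sub>E i\<in>I. X i)" for x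
    using that X by blast
  \<comment> \<open>Termwise sums need not be extensional; restricting the family to
    \<open>I\<close> repairs this without changing its sum.\<close>
  have mem: "(\<Oplus>\<^bsub>M\<^esub>i\<in>I. x i) \<in> ?S" if "x \<in> (\<Pi> i\<in>I. X i)" for x
  proof (rule image_eqI)
    show "restrict x I \<in> (\<Pi>\<^sub>E i\<in>I. X i)" using that by auto
    then show "(\<Oplus>\<^bsub>M\<^esub>i\<in>I. x i) = (\<Oplus>\<^bsub>M\<^esub>i\<in>I. restrict x I i)"
      by (intro finsum_cong' carr) auto
  qed
  show ?thesis
    unfolding submodule_iff[OF M]
  proof (intro conjI ballI)
    show "?S \<subseteq> carrier M" using carr by auto
    show "\<zero>\<^bsub>M\<^esub> \<in> ?S" using mem[of "\<lambda>_. \<zero>\<^bsub>M\<^esub>"] X by auto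
  next
    fix s s' assume "s \<in> ?S" "s' \<in> ?S"
    then obtain x x' where x: "x \<in> (\<Pi>\<^sub>E i\<in>I. X i)" "s = (\<Oplus>\<^bsub>M\<^esub>i\<in>I. x i)"
      and x': "x' \<in> (\<Pi>\<^sub>E i\<in>I. X i)" "s' = (\<Oplus>\<^bsub>M\<^esub>i\<in>I. x' i)" by blast
    then have "s \<oplus>\<^bsub>M\<^esub> s' = (\<Oplus>\<^bsub>M\<^esub>i\<in>I. x i \<oplus>\<^bsub>M\<^esub> x' i)" by (simp add: carr)
    moreover have "\<dots> \<in> ?S" using x x' X by (intro mem) (auto simp: PiE_mem)
    ultimately show "s \<oplus>\<^bsub>M\<^esub> s' \<in> ?S" by simp
  next
    fix a s assume a: "a \<in> carrier K" and "s \<in> ?S"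
    then obtain x where x: "x \<in> (\<Pi>\<^sub>E i\<in>I. X i)" "s = (\<Oplus>\<^bsub>M\<^esub>i\<in>I. x i)" by blast
    then have "a \<odot>\<^bsub>M\<^esub> s = (\<Oplus>\<^bsub>M\<^esub>i\<in>I. a \<odot>\<^bsub>M\<^esub> x i)"
      using a \<open>finite I\<close> by (simp add: carr finsum_smult_ldistr)
    moreover have "\<dots> \<in> ?S" using x a X by (intro mem) (auto simp: PiE_mem)
    ultimately show "a \<odot>\<^bsub>M\<^esub> s \<in> ?S" by simp
  qed
qed

text \<open>An element of one summand is the sum of the family that takes it at \<open>i\<close> and
  vanishes elsewhere.\<close>

lemma internal_direct_sum_component_subset:
  assumes M: "module K M" and S: "internal_direct_sum K M I X S" and i: "i \<in> I"
  shows "X i \<subseteq> S"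
proof
  interpret module K M by fact
  have fin: "finite I" and X: "\<And>i. i \<in> I \<Longrightarrow> submodule (X i) K M"
    and S: "S = (\<lambda>x. \<Oplus>\<^bsub>M\<^esub>i\<in>I. x i) ` (\<Pi>\<^sub>E i\<in>I. X i)"
    using S by (auto simp: internal_direct_sum_def bij_betw_def)
  note X = X[unfolded submodule_iff[OF M]]
  fix y assume y: "y \<in> X i"
  define x where "x = (\<lambda>j\<in>I. if i = j then y else \<zero>\<^bsub>M\<^esub>)"
  have yc: "y \<in> carrier M" using X i y by blast
  have "(\<Oplus>\<^bsub>M\<^esub>j\<in>I. x j) = (\<Oplus>\<^bsub>M\<^esub>j\<in>I. if i = j then y else \<zero>\<^bsub>M\<^esub>)"
    using yc by (intro finsum_cong') (auto simp: x_def)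
  also have "\<dots> = y" using finsum_singleton[OF i fin, of "\<lambda>_. y"] yc by simp
  finally show "y \<in> S"
    unfolding S using X y by (intro image_eqI[of _ _ x]) (auto simp: x_def simp del: restrict_apply)
qed

section \<open>Linear maps: extensionality, sums, composition, preimages and spans\<close>

lemma linI:
  assumes "f \<in> carrier V \<rightarrow>\<^sub>E carrier W"
    and "\<And>x y. \<lbrakk>x \<in> carrier V; y \<in> carrier V\<rbrakk> \<Longrightarrow> f (x \<oplus>\<^bsub>V\<^esub> y) = f x \<oplus>\<^bsub>W\<^esub> f y"
    and "\<And>a x. \<lbrakk>a \<in> carrier K; x \<in> carrier V\<rbrakk> \<Longrightarrow> f (a \<odot>\<^bsub>V\<^esub> x) = a \<odot>\<^bsub>W\<^esub> f x"
  shows "f \<in> lin K V W"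
  using assms by (auto simp: lin_def)

lemma linD:
  assumes "f \<in> lin K V W"
  shows "x \<in> carrier V \<Longrightarrow> f x \<in> carrier W"
    and "\<lbrakk>x \<in> carrier V; y \<in> carrier V\<rbrakk> \<Longrightarrow> f (x \<oplus>\<^bsub>V\<^esub> y) = f x \<oplus>\<^bsub>W\<^esub> f y"
    and "\<lbrakk>a \<in> carrier K; x \<in> carrier V\<rbrakk> \<Longrightarrow> f (a \<odot>\<^bsub>V\<^esub> x) = a \<odot>\<^bsub>W\<^esub> f x"
    and "x \<notin> carrier V \<Longrightarrow> f x = undefined"
  using assms by (auto simp: lin_def)

lemma lin_ext:
  assumes "f \<in> lin K V W" "f' \<in> lin K V W'" "\<And>x. x \<in> carrier V \<Longrightarrow> f x = f' x"
  shows "f = f'"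
proof
  show "f x = f' x" for x
    using assms linD(4)[of f K V W x] linD(4)[of f' K V W' x] by (cases "x \<in> carrier V") auto
qed

lemma lin_zero:
  assumes "module K V" "module K W" "f \<in> lin K V W"
  shows "f \<zero>\<^bsub>V\<^esub> = \<zero>\<^bsub>W\<^esub>"
proof -
  interpret V: module K V by fact
  interpret W: module K W by fact
  have "f (\<zero>\<^bsub>K\<^esub> \<odot>\<^bsub>V\<^esub> \<zero>\<^bsub>V\<^esub>) = \<zero>\<^bsub>K\<^esub> \<odot>\<^bsub>W\<^esub> f \<zero>\<^bsub>V\<^esub>"
    using assms by (intro linD(3)[OF assms(3)]) auto
  then show ?thesis using linD(1)[OF assms(3)] by simp
qed

lemma lin_finsum:
  assumes "module K V" "module K W" and f: "f \<in> lin K V W" and x: "x \<in> A \<rightarrow> carrier V"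
  shows "f (\<Oplus>\<^bsub>V\<^esub>i\<in>A. x i) = (\<Oplus>\<^bsub>W\<^esub>i\<in>A. f (x i))"
proof -
  interpret V: module K V by fact
  interpret W: module K W by fact
  from x show ?thesis
  proof (induction A rule: infinite_finite_induct)
    case (insert i A)
    then have "x i \<in> carrier V" "x \<in> A \<rightarrow> carrier V" by auto
    moreover from this have "f (x i) \<in> carrier W" "(\<lambda>i. f (x i)) \<in> A \<rightarrow> carrier W"
      using linD(1)[OF f] by auto
    ultimately show ?case using insert by (simp add: linD(2)[OF f])
  qed (use lin_zero assms in auto)
qed

lemma lin_compose:
  assumes "module K U" and f: "f \<in> lin K U V" and g: "g \<in> lin K V W"
  shows "compose (carrier U) g f \<in> lin K U W"
proof -
  interpret U: module K U by fact
  show ?thesis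
    using linD[OF f] linD[OF g] by (intro linI) (auto simp: compose_def)
qed

lemma submodule_vimage:
  assumes "module K V" "module K W" and f: "f \<in> lin K V W" and N: "submodule N K W"
  shows "submodule {x \<in> carrier V. f x \<in> N} K V"
proof -
  interpret V: module K V by fact
  show ?thesis
    using N lin_zero[OF assms(1-3)] linD[OF f]
    unfolding submodule_iff[OF assms(1)] submodule_iff[OF assms(2)] by auto
qed

text \<open>The preimage of \<open>N\<close> is a subspace containing \<open>S\<close>, hence
  contains the hull. This reduces a claim about a whole summand of a tensor product to its pure
  tensors.\<close>

lemma lin_image_vspan:
  assumes "module K V" "module K W" "f \<in> lin K V W" "submodule N K W"
    and "S \<subseteq> carrier V" "f ` S \<subseteq> N"
  shows "f ` vspan K V S \<subseteq> N"
proof -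
  have "vspan K V S \<subseteq> {x \<in> carrier V. f x \<in> N}"
    unfolding vspan_def
    using assms(5,6) by (intro hull_minimal submodule_vimage[OF assms(1-4)]) auto
  then show ?thesis by auto
qed

text \<open>Being a module depends on four fields only. This allows a change of record extension,
  and leaves the \<open>undefined\<close> ring fields of \<open>ihom\<close> harmless.\<close>

lemma module_cong:
  fixes M :: "('k, 'a, 'm) module_scheme" and N :: "('k, 'a, 'n) module_scheme"
  assumes M: "module K M" and eq: "carrier N = carrier M" "zero N = zero M" "add N = add M"
    "smult N = smult M"
  shows "module K N"
proof -
  interpret module K M by fact
  show ?thesis
  proof (rule moduleI[OF R.is_cring], rule abelian_groupI)
    fix x assume "x \<in> carrier N"
    then show "\<exists>y\<in>carrier N. y \<oplus>\<^bsub>N\<^esub> x = \<zero>\<^bsub>N\<^esub>"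
      by (auto simp: eq M.l_neg intro: bexI[of _ "\<ominus>\<^bsub>M\<^esub> x"])
  qed (auto simp: eq M.a_assoc M.a_comm M.a_lcomm smult_l_distr smult_r_distr smult_assoc1)
qed

text \<open>The definition tests against plain module records, whereas graded spaces carry the extra
  field \<open>component\<close>. Truncating \<open>Y\<close> forgets that field and changes neither
  bilinear nor linear maps.\<close>

lemma tensor_product_ex1:
  fixes V :: "('k, 'a, 'm) module_scheme" and X :: "('k, 'c, 'l) module_scheme"
    and Y :: "('k, 'c, 'z) module_scheme"
  assumes "is_tensor_product K V W X t" "module K Y" "bilinear_map K V W Y b"
  shows "\<exists>!f. f \<in> lin K X Y \<and> (\<forall>v\<in>carrier V. \<forall>w\<in>carrier W. f (t v w) = b v w)"
proof -
  have "bilinear_map K V W (module.truncate Y) b" "lin K X (module.truncate Y) = lin K X Y"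
    using assms(3) by (auto simp: bilinear_map_def lin_def module.truncate_def)
  moreover have "module K (module.truncate Y)"
    by (rule module_cong[OF assms(2)]) (simp_all add: module.truncate_def)
  ultimately show ?thesis
    using assms(1) unfolding is_tensor_product_def by metis
qed

section \<open>Graded spaces\<close>

lemma graded_spaceD:
  assumes "graded_space G K V"
  shows "module K V"
    and "g \<in> carrier G \<Longrightarrow> submodule (component V g) K V"
    and "\<lbrakk>g \<in> carrier G; x \<in> component V g\<rbrakk> \<Longrightarrow> x \<in> carrier V"
    and "bij_betw (\<lambda>x. \<Oplus>\<^bsub>V\<^esub>i\<in>carrier G. x i) (\<Pi>\<^sub>E i\<in>carrier G. component V i) (carrier V)"
proof -
  show V: "module K V"
    and "bij_betw (\<lambda>x. \<Oplus>\<^bsub>V\<^esub>i\<in>carrier G. x i) (\<Pi>\<^sub>E i\<in>carrier G. component V i) (carrier V)"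
    using assms by (auto simp: graded_space_def internal_direct_sum_def)
  show sub: "submodule (component V g) K V" if "g \<in> carrier G"
    using assms that by (auto simp: graded_space_def internal_direct_sum_def)
  show "x \<in> carrier V" if "g \<in> carrier G" "x \<in> component V g"
    using sub[OF that(1)] that(2) by (auto simp: submodule_iff[OF V])
qed

lemma graded_space_decompose:
  assumes "graded_space G K V" "v \<in> carrier V"
  obtains x where "\<And>g. g \<in> carrier G \<Longrightarrow> x g \<in> component V g" "v = (\<Oplus>\<^bsub>V\<^esub>g\<in>carrier G. x g)"
proof -
  have "v \<in> (\<lambda>x. \<Oplus>\<^bsub>V\<^esub>i\<in>carrier G. x i) ` (\<Pi>\<^sub>E i\<in>carrier G. component V i)"
    using bij_betw_imp_surj_on[OF graded_spaceD(4)[OF assms(1)]] assms(2) by simp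
  then show thesis using that by (blast dest: PiE_mem)
qed

text \<open>Every vector is a sum of homogeneous ones, and linear maps commute with sums.\<close>

lemma graded_lin_ext:
  assumes V: "graded_space G K V" and W: "module K W"
    and f: "f \<in> lin K V W" and f': "f' \<in> lin K V W"
    and eq: "\<And>g v. \<lbrakk>g \<in> carrier G; v \<in> component V g\<rbrakk> \<Longrightarrow> f v = f' v"
  shows "f = f'"
proof (rule lin_ext[OF f f'])
  interpret W: module K W by fact
  fix v assume "v \<in> carrier V"
  then obtain x where x: "\<And>g. g \<in> carrier G \<Longrightarrow> x g \<in> component V g"
    and v: "v = (\<Oplus>\<^bsub>V\<^esub>g\<in>carrier G. x g)"
    using graded_space_decompose[OF V] by metis
  have xc: "x \<in> carrier G \<rightarrow> carrier V" using x graded_spaceD(3)[OF V] by blast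
  note sum = lin_finsum[OF graded_spaceD(1)[OF V] W _ xc]
  show "f v = f' v"
    unfolding v sum[OF f] sum[OF f']
    using x eq xc by (intro W.finsum_cong') (auto intro!: linD(1)[OF f'])
qed

lemma ghomD:
  assumes "f \<in> ghom G K V W"
  shows "f \<in> lin K V W" "\<lbrakk>g \<in> carrier G; x \<in> component V g\<rbrakk> \<Longrightarrow> f x \<in> component W g"
  using assms by (auto simp: ghom_def)

lemma ghom_compose:
  assumes U: "graded_space G K U" and f: "f \<in> ghom G K U V" and g: "g \<in> ghom G K V W"
  shows "compose (carrier U) g f \<in> ghom G K U W"
proof -
  have "compose (carrier U) g f x \<in> component W h" if "h \<in> carrier G" "x \<in> component U h" for h x
    using ghomD(2)[OF g that(1) ghomD(2)[OF f that]] graded_spaceD(3)[OF U that]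
    by (simp add: compose_def)
  then show ?thesis
    using lin_compose[OF graded_spaceD(1)[OF U] ghomD(1)[OF f] ghomD(1)[OF g]]
    by (auto simp: ghom_def)
qed

text \<open>Composition with the inverse isomorphism undoes composition with \<open>e\<close>. It
  serves to replace \<open>ihom\<close> by an isomorphic object whose carrier type is that of the
  category.\<close>

lemma bij_betw_ghom_compose_giso:
  assumes U: "graded_space G K U" and e: "e \<in> giso G K V W"
  shows "bij_betw (\<lambda>f. compose (carrier U) e f) (ghom G K U V) (ghom G K U W)"
proof -
  obtain e' where ee': "e \<in> ghom G K V W" "e' \<in> ghom G K W V"
    and inv: "compose (carrier V) e' e = idm V" "compose (carrier W) e e' = idm W"
    using e by (auto simp: giso_def)
  have 1: "e' (e v) = v" if "v \<in> carrier V" for v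
    using fun_cong[OF inv(1), of v] that by (simp add: compose_def)
  have 2: "e (e' w) = w" if "w \<in> carrier W" for w
    using fun_cong[OF inv(2), of w] that by (simp add: compose_def)
  note closed = ghom_compose[OF U _ ee'(1)] ghom_compose[OF U _ ee'(2)]
  show ?thesis
  proof (rule bij_betw_byWitness[where f' = "\<lambda>f. compose (carrier U) e' f"])
    show "\<forall>f\<in>ghom G K U V. compose (carrier U) e' (compose (carrier U) e f) = f"
    proof
      fix f assume f: "f \<in> ghom G K U V"
      show "compose (carrier U) e' (compose (carrier U) e f) = f"
        using 1 linD(1)[OF ghomD(1)[OF f]]
        by (intro lin_ext[OF closed(2)[OF closed(1)[OF f], THEN ghomD(1)] ghomD(1)[OF f]])
          (simp add: compose_def)
    qed
    show "\<forall>f\<in>ghom G K U W. compose (carrier U) e (compose (carrier U) e' f) = f"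
    proof
      fix f assume f: "f \<in> ghom G K U W"
      show "compose (carrier U) e (compose (carrier U) e' f) = f"
        using 2 linD(1)[OF ghomD(1)[OF f]]
        by (intro lin_ext[OF closed(1)[OF closed(2)[OF f], THEN ghomD(1)] ghomD(1)[OF f]])
          (simp add: compose_def)
    qed
  qed (use closed in auto)
qed

section \<open>The internal hom\<close>

lemma lin_space_simps [simp]:
  "carrier (lin_space K V W) = lin K V W"
  "\<zero>\<^bsub>lin_space K V W\<^esub> = (\<lambda>v\<in>carrier V. \<zero>\<^bsub>W\<^esub>)"
  "f \<oplus>\<^bsub>lin_space K V W\<^esub> f' = (\<lambda>v\<in>carrier V. f v \<oplus>\<^bsub>W\<^esub> f' v)"
  "a \<odot>\<^bsub>lin_space K V W\<^esub> f = (\<lambda>v\<in>carrier V. a \<odot>\<^bsub>W\<^esub> f v)"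
  by (simp_all add: lin_space_def)

lemma ihom_simps [simp]:
  "zero (ihom G K V W) = zero (lin_space K V W)"
  "add (ihom G K V W) = add (lin_space K V W)"
  "smult (ihom G K V W) = smult (lin_space K V W)"
  "component (ihom G K V W) g = hom_deg G K g V W"
  by (simp_all add: ihom_def)

lemma lin_space_module:
  assumes "module K V" "module K W"
  shows "module K (lin_space K V W)"
proof -
  interpret V: module K V by fact
  interpret W: module K W by fact
  have zero: "(\<lambda>v\<in>carrier V. \<zero>\<^bsub>W\<^esub>) \<in> lin K V W"
    by (rule linI) auto
  have add: "(\<lambda>v\<in>carrier V. f v \<oplus>\<^bsub>W\<^esub> f' v) \<in> lin K V W"
    if "f \<in> lin K V W" "f' \<in> lin K V W" for f f'
    using that[THEN linD(1)] that[THEN linD(2)] that[THEN linD(3)]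
    by (intro linI) (auto simp: W.a_ac W.smult_r_distr)
  \<comment> \<open>Commutativity of \<open>K\<close> enters here: \<open>a\<close> has to move past
    the scalar of the linearity condition.\<close>
  have smult: "(\<lambda>v\<in>carrier V. a \<odot>\<^bsub>W\<^esub> f v) \<in> lin K V W"
    if "f \<in> lin K V W" "a \<in> carrier K" for f a
    using that(1)[THEN linD(1)] that(1)[THEN linD(2)] that(1)[THEN linD(3)] that(2)
    by (intro linI)
      (auto simp: W.smult_r_distr W.smult_assoc1[symmetric] V.R.m_comm)
  show ?thesis
  proof (rule moduleI[OF V.R.is_cring], rule abelian_groupI)
    fix f assume f: "f \<in> carrier (lin_space K V W)"
    show "\<exists>y\<in>carrier (lin_space K V W). y \<oplus>\<^bsub>lin_space K V W\<^esub> f = \<zero>\<^bsub>lin_space K V W\<^esub>"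
    \<comment> \<open>The additive inverse is written as the multiple by \<ominus>1, so that its
      linearity is an instance of \<open>smult\<close>.\<close>
    proof
      show "(\<lambda>v\<in>carrier V. (\<ominus>\<^bsub>K\<^esub> \<one>\<^bsub>K\<^esub>) \<odot>\<^bsub>W\<^esub> f v) \<in> carrier (lin_space K V W)"
        using smult f by simp
      show "(\<lambda>v\<in>carrier V. (\<ominus>\<^bsub>K\<^esub> \<one>\<^bsub>K\<^esub>) \<odot>\<^bsub>W\<^esub> f v) \<oplus>\<^bsub>lin_space K V W\<^esub> f = \<zero>\<^bsub>lin_space K V W\<^esub>"
        using f by (auto intro!: restrict_ext simp: W.smult_l_minus W.l_neg linD(1))
    qed
    show "\<zero>\<^bsub>lin_space K V W\<^esub> \<oplus>\<^bsub>lin_space K V W\<^esub> f = f"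
      "\<one>\<^bsub>K\<^esub> \<odot>\<^bsub>lin_space K V W\<^esub> f = f"
      using f linD[of f K V W] by (auto intro!: ext)
  qed (use zero add smult in \<open>auto intro!: restrict_ext simp: linD(1) W.a_ac
      W.smult_l_distr W.smult_r_distr W.smult_assoc1\<close>)
qed

text \<open>Evaluation at \<open>v\<close> is a linear map from \<open>lin_space K V W\<close> to
  \<open>W\<close>, so it commutes with sums.\<close>

lemma lin_space_finsum_apply:
  assumes "module K V" "module K W" "F \<in> A \<rightarrow> lin K V W" "v \<in> carrier V"
  shows "(\<Oplus>\<^bsub>lin_space K V W\<^esub>g\<in>A. F g) v = (\<Oplus>\<^bsub>W\<^esub>g\<in>A. F g v)"
proof -
  interpret L: module K "lin_space K V W" by (intro lin_space_module assms)
  interpret W: module K W by fact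
  have "(\<lambda>f\<in>lin K V W. f v) \<in> lin K (lin_space K V W) W"
    using assms(4) L.a_closed L.smult_closed by (intro linI) (auto simp: linD(1))
  from lin_finsum[OF L.module_axioms assms(2) this, of F A] assms(3,4)
  have "(\<Oplus>\<^bsub>lin_space K V W\<^esub>g\<in>A. F g) v = (\<Oplus>\<^bsub>W\<^esub>g\<in>A. (\<lambda>f\<in>lin K V W. f v) (F g))"
    using L.finsum_closed[of F A] by simp
  also have "\<dots> = (\<Oplus>\<^bsub>W\<^esub>g\<in>A. F g v)"
    using assms(3) linD(1)[OF _ assms(4), of _ K W]
    by (intro W.finsum_cong') (auto simp: Pi_iff)
  finally show ?thesis .
qed

lemma hom_deg_submodule:
  assumes "group G" "graded_space G K V" "graded_space G K W" "g \<in> carrier G"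
  shows "submodule (hom_deg G K g V W) K (lin_space K V W)"
proof -
  interpret G: group G by fact
  note V = graded_spaceD[OF assms(2)] and W = graded_spaceD[OF assms(3)]
  interpret L: module K "lin_space K V W" by (intro lin_space_module V W)
  have sub: "submodule (component W (g \<otimes>\<^bsub>G\<^esub> h)) K W" if "h \<in> carrier G" for h
    using W(2) assms(4) that by simp
  show ?thesis
    unfolding submodule_iff[OF L.module_axioms] hom_deg_def
    using sub[unfolded submodule_iff[OF W(1)]] V(3) L.zero_closed L.a_closed L.smult_closed
    by (auto simp: image_subset_iff)
qed

section \<open>The space of sums of homogeneous maps and its grading\<close>

lemma ihom_carrier_submodule:
  assumes "group G" "finite (carrier G)" "graded_space G K V" "graded_space G K W"
  shows "submodule (carrier (ihom G K V W)) K (lin_space K V W)"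
proof -
  have "submodule ((\<lambda>F. \<Oplus>\<^bsub>lin_space K V W\<^esub>g\<in>carrier G. F g) `
      (\<Pi>\<^sub>E g\<in>carrier G. hom_deg G K g V W)) K (lin_space K V W)"
    using assms
    by (intro submodule_sum_image lin_space_module hom_deg_submodule graded_spaceD(1))
  then show ?thesis by (simp add: ihom_def)
qed

lemma ihom_carrier_subset:
  assumes "group G" "finite (carrier G)" "graded_space G K V" "graded_space G K W"
  shows "carrier (ihom G K V W) \<subseteq> lin K V W"
  using ihom_carrier_submodule[OF assms] graded_spaceD(1)[OF assms(3)] graded_spaceD(1)[OF assms(4)]
  by (simp add: submodule_iff[OF lin_space_module])

lemma ihom_module:
  assumes "group G" "finite (carrier G)" "graded_space G K V" "graded_space G K W"
  shows "module K (ihom G K V W)"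
  by (rule module_cong[OF submodule.submodule_is_module[OF ihom_carrier_submodule[OF assms]
          lin_space_module[OF graded_spaceD(1)[OF assms(3)] graded_spaceD(1)[OF assms(4)]]]])
    auto

text \<open>The operations of \<open>ihom\<close> are those of \<open>lin_space\<close>, so
  linearity and membership of the values can be treated separately.\<close>

lemma lin_ihom_iff:
  assumes "group G" "finite (carrier G)" "graded_space G K V" "graded_space G K W"
  shows "f \<in> lin K U (ihom G K V W) \<longleftrightarrow>
    f \<in> lin K U (lin_space K V W) \<and> f ` carrier U \<subseteq> carrier (ihom G K V W)"
  using ihom_carrier_subset[OF assms] by (auto simp: lin_def PiE_iff)

text \<open>A sum in \<open>ihom\<close> refers to a different structure than one in
  \<open>lin_space\<close>, so the two are not equal by definition. The inclusion is linear,
  however, and commutes with sums.\<close>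

lemma ihom_finsum:
  assumes GVW: "group G" "finite (carrier G)" "graded_space G K V" "graded_space G K W"
    and F: "F \<in> A \<rightarrow> carrier (ihom G K V W)"
  shows "(\<Oplus>\<^bsub>ihom G K V W\<^esub>i\<in>A. F i) = (\<Oplus>\<^bsub>lin_space K V W\<^esub>i\<in>A. F i)"
proof -
  note [simp] = ihom_carrier_subset[OF GVW, THEN subsetD]
  interpret I: module K "ihom G K V W" using GVW by (rule ihom_module)
  interpret L: module K "lin_space K V W" using GVW by (intro lin_space_module graded_spaceD)
  have "idm (ihom G K V W) \<in> lin K (ihom G K V W) (lin_space K V W)"
    using I.a_closed I.smult_closed by (intro linI) auto
  from lin_finsum[OF I.module_axioms L.module_axioms this F]
  have "(\<Oplus>\<^bsub>ihom G K V W\<^esub>i\<in>A. F i) = (\<Oplus>\<^bsub>lin_space K V W\<^esub>i\<in>A. idm (ihom G K V W) (F i))"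
    using I.finsum_closed[OF F] by simp
  also have "\<dots> = (\<Oplus>\<^bsub>lin_space K V W\<^esub>i\<in>A. F i)"
    using F by (intro L.finsum_cong') (auto simp: Pi_iff)
  finally show ?thesis .
qed

lemma hom_deg_subset_ihom:
  assumes GVW: "group G" "finite (carrier G)" "graded_space G K V" "graded_space G K W"
    and g: "g \<in> carrier G"
  shows "hom_deg G K g V W \<subseteq> carrier (ihom G K V W)"
proof -
  interpret L: module K "lin_space K V W" using GVW by (intro lin_space_module graded_spaceD)
  have H: "h \<in> carrier G \<Longrightarrow> hom_deg G K h V W \<subseteq> lin K V W" for h
    by (auto simp: hom_deg_def)
  show ?thesis
  proof
    fix f assume f: "f \<in> hom_deg G K g V W"
    define F where "F = (\<lambda>h\<in>carrier G. if g = h then f else \<zero>\<^bsub>lin_space K V W\<^esub>)"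
    have "F \<in> (\<Pi>\<^sub>E h\<in>carrier G. hom_deg G K h V W)"
      using f hom_deg_submodule[OF GVW(1,3,4), unfolded submodule_iff[OF L.module_axioms]]
      by (auto simp: F_def)
    moreover have "(\<Oplus>\<^bsub>lin_space K V W\<^esub>h\<in>carrier G. F h) =
        (\<Oplus>\<^bsub>lin_space K V W\<^esub>h\<in>carrier G. if g = h then f else \<zero>\<^bsub>lin_space K V W\<^esub>)"
      using f H[OF g] L.zero_closed by (intro L.finsum_cong') (auto simp: F_def)
    moreover have "\<dots> = f"
      using L.finsum_singleton[OF g GVW(2), of "\<lambda>_. f"] f H[OF g] by auto
    ultimately show "f \<in> carrier (ihom G K V W)"
      by (auto simp: ihom_def intro!: image_eqI[of _ _ F])
  qed
qed

text \<open>Evaluating on \<open>V\<^sub>h\<close> separates the summands: \<open>F\<^sub>g\<close> takes values in \<open>W\<^bsub>gh\<^esub>\<close> there.\<close>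

lemma hom_deg_sum_inj:
  fixes V :: "('k, 'a, 'g) graded" and W :: "('k, 'b, 'g) graded"
  assumes GVW: "group G" "finite (carrier G)" "graded_space G K V" "graded_space G K W"
  shows "inj_on (\<lambda>F. \<Oplus>\<^bsub>lin_space K V W\<^esub>g\<in>carrier G. F g) (\<Pi>\<^sub>E g\<in>carrier G. hom_deg G K g V W)"
proof (rule inj_onI, rule PiE_ext)
  interpret G: group G by fact
  note V = graded_spaceD[OF GVW(3)] and W = graded_spaceD[OF GVW(4)]
  interpret W: module K W by (rule W(1))
  let ?P = "\<Pi>\<^sub>E g\<in>carrier G. hom_deg G K g V W"
  fix F F' g
  assume F: "F \<in> ?P" and F': "F' \<in> ?P" and g: "g \<in> carrier G"
    and eq: "(\<Oplus>\<^bsub>lin_space K V W\<^esub>g\<in>carrier G. F g) = (\<Oplus>\<^bsub>lin_space K V W\<^esub>g\<in>carrier G. F' g)"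
  have lin: "E k \<in> lin K V W" if "E \<in> ?P" "k \<in> carrier G" for E k
    using that by (auto simp: hom_deg_def)
  show "F g = F' g"
  proof (rule graded_lin_ext[OF GVW(3) W(1) lin[OF F g] lin[OF F' g]])
    fix h v assume h: "h \<in> carrier G" and v: "v \<in> component V h"
    have vc: "v \<in> carrier V" using V(3) h v by blast
    \<comment> \<open>\<open>E g\<close> moves \<open>v\<close> from degree \<open>h\<close> to
      degree \<open>g \<otimes> h\<close>. Hence the part of degree \<open>k\<close> of the total
      value comes from the index \<open>k \<otimes> inv h\<close>, and \<open>x E\<close> is the
      homogeneous decomposition of that value in \<open>W\<close>.\<close>
    define x where "x E = (\<lambda>k\<in>carrier G. E (k \<otimes>\<^bsub>G\<^esub> inv\<^bsub>G\<^esub> h) v)" for E :: "'g \<Rightarrow> 'a \<Rightarrow> 'b"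
    have x: "x E \<in> (\<Pi>\<^sub>E k\<in>carrier G. component W k)" if "E \<in> ?P" for E
    proof -
      have "E (k \<otimes>\<^bsub>G\<^esub> inv\<^bsub>G\<^esub> h) v \<in> component W k" if k: "k \<in> carrier G" for k
      proof -
        have "E (k \<otimes>\<^bsub>G\<^esub> inv\<^bsub>G\<^esub> h) \<in> hom_deg G K (k \<otimes>\<^bsub>G\<^esub> inv\<^bsub>G\<^esub> h) V W"
          using \<open>E \<in> ?P\<close> k h by (intro PiE_mem[of E]) auto
        then have "E (k \<otimes>\<^bsub>G\<^esub> inv\<^bsub>G\<^esub> h) v \<in> component W (k \<otimes>\<^bsub>G\<^esub> inv\<^bsub>G\<^esub> h \<otimes>\<^bsub>G\<^esub> h)"
          using h v by (auto simp: hom_deg_def)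
        then show ?thesis using k h by (simp add: G.m_assoc)
      qed
      then show ?thesis by (auto simp: x_def)
    qed
    \<comment> \<open>Right translation by \<open>h\<close> permutes the group; it converts the sum
      over degrees in \<open>W\<close> into the sum over degrees of maps.\<close>
    have img: "(\<lambda>k. k \<otimes>\<^bsub>G\<^esub> h) ` carrier G = carrier G"
    proof
      show "carrier G \<subseteq> (\<lambda>k. k \<otimes>\<^bsub>G\<^esub> h) ` carrier G"
      proof
        fix k assume "k \<in> carrier G"
        then show "k \<in> (\<lambda>k. k \<otimes>\<^bsub>G\<^esub> h) ` carrier G"
          using h by (intro image_eqI[of _ _ "k \<otimes>\<^bsub>G\<^esub> inv\<^bsub>G\<^esub> h"]) (auto simp: G.m_assoc)
      qed
    qed (use h in auto)
    have sum: "(\<Oplus>\<^bsub>W\<^esub>k\<in>carrier G. x E k) = (\<Oplus>\<^bsub>lin_space K V W\<^esub>k\<in>carrier G. E k) v"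
      if E: "E \<in> ?P" for E
    proof -
      have xc: "x E \<in> carrier G \<rightarrow> carrier W" using x[OF E] W(3) by blast
      have "(\<Oplus>\<^bsub>W\<^esub>k\<in>carrier G. x E k) = (\<Oplus>\<^bsub>W\<^esub>k\<in>carrier G. x E (k \<otimes>\<^bsub>G\<^esub> h))"
        using W.finsum_reindex[of "x E" "\<lambda>k. k \<otimes>\<^bsub>G\<^esub> h" "carrier G"] xc h
        by (simp add: img G.inj_on_multc)
      also have "\<dots> = (\<Oplus>\<^bsub>W\<^esub>k\<in>carrier G. E k v)"
        using lin[OF E, THEN linD(1)] vc h
        by (intro W.finsum_cong') (auto simp: x_def G.m_assoc)
      also have "\<dots> = (\<Oplus>\<^bsub>lin_space K V W\<^esub>k\<in>carrier G. E k) v"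
        using lin[OF E] by (intro lin_space_finsum_apply[symmetric] V(1) W(1) vc) auto
      finally show ?thesis .
    qed
    \<comment> \<open>Both families decompose the same vector of \<open>W\<close>, and homogeneous
      decompositions there are unique. Reading off the entry at \<open>g \<otimes> h\<close> then
      recovers the value at \<open>g\<close>.\<close>
    have "x F = x F'"
      using sum[OF F] sum[OF F'] eq
      by (intro inj_onD[OF bij_betw_imp_inj_on[OF W(4)] _ x[OF F] x[OF F']]) simp
    from fun_cong[OF this, of "g \<otimes>\<^bsub>G\<^esub> h"] show "F g v = F' g v"
      using g h by (simp add: x_def G.m_assoc)
  qed
qed auto

text \<open>The carrier is defined as the image of the sum map, so surjectivity is built in and all
  content lies in injectivity. What remains is to pass from sums in \<open>lin_space\<close> to sums
  in \<open>ihom\<close>.\<close>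

lemma ihom_graded_space:
  assumes GVW: "group G" "finite (carrier G)" "graded_space G K V" "graded_space G K W"
  shows "graded_space G K (ihom G K V W)"
proof -
  interpret I: module K "ihom G K V W" using GVW by (rule ihom_module)
  interpret L: module K "lin_space K V W" using GVW by (intro lin_space_module graded_spaceD)
  let ?P = "\<Pi>\<^sub>E g\<in>carrier G. hom_deg G K g V W"
  have sub: "submodule (hom_deg G K g V W) K (ihom G K V W)" if "g \<in> carrier G" for g
    using hom_deg_submodule[OF GVW(1,3,4) that] hom_deg_subset_ihom[OF GVW that]
    by (simp add: submodule_iff[OF I.module_axioms] submodule_iff[OF L.module_axioms])
  have "bij_betw (\<lambda>F. \<Oplus>\<^bsub>lin_space K V W\<^esub>g\<in>carrier G. F g) ?P (carrier (ihom G K V W))"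
    using hom_deg_sum_inj[OF GVW] by (simp add: bij_betw_def ihom_def)
  also have "?this \<longleftrightarrow> bij_betw (\<lambda>F. \<Oplus>\<^bsub>ihom G K V W\<^esub>g\<in>carrier G. F g) ?P (carrier (ihom G K V W))"
    using hom_deg_subset_ihom[OF GVW] by (intro bij_betw_cong ihom_finsum[OF GVW, symmetric]) blast
  finally show ?thesis
    using sub I.module_axioms GVW(2) by (simp add: graded_space_def internal_direct_sum_def)
qed

text \<open>For homogeneous \<open>u\<close> the degree condition already puts \<open>f u\<close>
  into the carrier of \<open>ihom\<close>. A general \<open>u\<close> is a sum of such vectors, and
  the carrier is closed under sums.\<close>

lemma ghom_ihomI:
  assumes U: "graded_space G K U"
    and GVW: "group G" "finite (carrier G)" "graded_space G K V" "graded_space G K W"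
    and f: "f \<in> lin K U (lin_space K V W)"
    and deg: "\<And>g u. \<lbrakk>g \<in> carrier G; u \<in> component U g\<rbrakk> \<Longrightarrow> f u \<in> hom_deg G K g V W"
  shows "f \<in> ghom G K U (ihom G K V W)"
proof -
  interpret L: module K "lin_space K V W" using GVW by (intro lin_space_module graded_spaceD)
  have "f u \<in> carrier (ihom G K V W)" if u: "u \<in> carrier U" for u
  proof -
    obtain x where x: "\<And>g. g \<in> carrier G \<Longrightarrow> x g \<in> component U g"
      and sum: "u = (\<Oplus>\<^bsub>U\<^esub>g\<in>carrier G. x g)"
      using graded_space_decompose[OF U u] by metis
    have "f u = (\<Oplus>\<^bsub>lin_space K V W\<^esub>g\<in>carrier G. f (x g))"
      unfolding sum using x graded_spaceD(3)[OF U]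
      by (intro lin_finsum[OF graded_spaceD(1)[OF U] L.module_axioms f]) blast
    moreover have "\<dots> \<in> carrier (ihom G K V W)"
      using x deg hom_deg_subset_ihom[OF GVW]
      by (intro submodule_finsum[OF L.module_axioms ihom_carrier_submodule[OF GVW]]) blast
    ultimately show ?thesis by simp
  qed
  then show ?thesis
    using f deg by (auto simp: ghom_def lin_ihom_iff[OF GVW])
qed

lemma ihom_map_ghom:
  assumes G: "group G" "finite (carrier G)"
    and V: "graded_space G K V" and W: "graded_space G K W"
    and V': "graded_space G K V'" and W': "graded_space G K W'"
    and q: "q \<in> ghom G K V' V" and r: "r \<in> ghom G K W W'"
  shows "ihom_map G K V W V' q r \<in> ghom G K (ihom G K V W) (ihom G K V' W')"
proof -
  interpret I: module K "ihom G K V W" using G V W by (rule ihom_module)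
  interpret V': module K V' by (rule graded_spaceD(1)[OF V'])
  note lin = ihom_carrier_subset[OF G V W, THEN subsetD]
  note qD = linD[OF ghomD(1)[OF q]] and rD = linD[OF ghomD(1)[OF r]]
  have mem: "(\<lambda>v\<in>carrier V'. r (f (q v))) \<in> lin K V' W'" if "f \<in> lin K V W" for f
    using linD[OF that] qD rD by (intro linI) auto
  show ?thesis
  proof (rule ghom_ihomI[OF ihom_graded_space[OF G V W] G V' W'])
    show "ihom_map G K V W V' q r \<in> lin K (ihom G K V W) (lin_space K V' W')"
      using mem lin I.a_closed I.smult_closed
      by (intro linI) (auto simp: ihom_map_def qD(1) rD(2,3) linD(1)[OF lin] intro!: restrict_ext)
  next
    fix g f assume g: "g \<in> carrier G" and "f \<in> component (ihom G K V W) g"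
    then have f: "f \<in> hom_deg G K g V W" by simp
    then have "f \<in> carrier (ihom G K V W)" "f \<in> lin K V W"
      using hom_deg_subset_ihom[OF G V W g] lin by blast+
    \<comment> \<open>Only \<open>f\<close> shifts the degree; \<open>q\<close> and \<open>r\<close>
      preserve it.\<close>
    moreover have "r (f (q v)) \<in> component W' (g \<otimes>\<^bsub>G\<^esub> h)" if "h \<in> carrier G" "v \<in> component V' h" for h v
    proof -
      interpret G: group G by fact
      have "f (q v) \<in> component W (g \<otimes>\<^bsub>G\<^esub> h)"
        using f ghomD(2)[OF q that] that by (auto simp: hom_deg_def)
      then show ?thesis using ghomD(2)[OF r] g that by simp
    qed
    ultimately show "ihom_map G K V W V' q r f \<in> hom_deg G K g V' W'"
      using mem graded_spaceD(3)[OF V'] by (auto simp: ihom_map_def hom_deg_def)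
  qed
qed

section \<open>Currying\<close>

text \<open>Both binders are restricted because elements of \<open>ghom G K U (ihom G K V W)\<close>
  are extensional in \<open>u\<close> and their values are extensional in \<open>v\<close>.\<close>

definition curry_hom ::
  "('k, 'a, 'm) module_scheme \<Rightarrow> ('k, 'b, 'n) module_scheme \<Rightarrow> ('a \<Rightarrow> 'b \<Rightarrow> 'c) \<Rightarrow>
   ('c \<Rightarrow> 'd) \<Rightarrow> 'a \<Rightarrow> 'b \<Rightarrow> 'd"
  where "curry_hom U V t f = (\<lambda>u\<in>carrier U. \<lambda>v\<in>carrier V. f (t u v))"

section \<open>Degrees in a graded tensor product\<close>

lemma graded_tensor_closed:
  assumes "graded_tensor G K U V X t" "u \<in> carrier U" "v \<in> carrier V"
  shows "t u v \<in> carrier X"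
  using assms by (auto simp: graded_tensor_def is_tensor_product_def bilinear_map_def)

text \<open>The pure tensor is a generator of the summand with index \<open>(g, h)\<close>, one of
  the summands of the component of degree \<open>g \<otimes> h\<close>.\<close>

lemma graded_tensor_component:
  assumes X: "graded_tensor G K U V X t" and G: "group G"
    and U: "graded_space G K U" and V: "graded_space G K V"
    and g: "g \<in> carrier G" "u \<in> component U g" and h: "h \<in> carrier G" "v \<in> component V h"
  shows "t u v \<in> component X (g \<otimes>\<^bsub>G\<^esub> h)"
proof -
  interpret G: group G by fact
  let ?I = "{(h', k). h' \<in> carrier G \<and> k \<in> carrier G \<and> h' \<otimes>\<^bsub>G\<^esub> k = g \<otimes>\<^bsub>G\<^esub> h}"
  let ?S = "\<lambda>h' k. {t v w | v w. v \<in> component U h' \<and> w \<in> component V k}"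
  have "internal_direct_sum K X ?I (\<lambda>(h', k). vspan K X (?S h' k)) (component X (g \<otimes>\<^bsub>G\<^esub> h))"
    and "module K X"
    using X g h by (auto simp: graded_tensor_def graded_space_def)
  from internal_direct_sum_component_subset[OF this(2,1), of "(g, h)"]
  have "vspan K X (?S g h) \<subseteq> component X (g \<otimes>\<^bsub>G\<^esub> h)" using g h by simp
  moreover have "t u v \<in> vspan K X (?S g h)"
    unfolding vspan_def using g h by (intro hull_inc) auto
  ultimately show ?thesis by blast
qed

lemma graded_tensor_ghomI:
  assumes X: "graded_tensor G K U V X t" and G: "group G"
    and U: "graded_space G K U" and V: "graded_space G K V" and W: "graded_space G K W"
    and f: "f \<in> lin K X W"
    and deg: "\<And>h k u v. \<lbrakk>h \<in> carrier G; k \<in> carrier G; u \<in> component U h; v \<in> component V k\<rbrakk>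
      \<Longrightarrow> f (t u v) \<in> component W (h \<otimes>\<^bsub>G\<^esub> k)"
  shows "f \<in> ghom G K X W"
proof -
  have X': "module K X" using X by (simp add: graded_tensor_def graded_space_def)
  have "f x \<in> component W g" if g: "g \<in> carrier G" and x: "x \<in> component X g" for g x
  proof -
    let ?I = "{(h, k). h \<in> carrier G \<and> k \<in> carrier G \<and> h \<otimes>\<^bsub>G\<^esub> k = g}"
    let ?S = "\<lambda>(h, k). {t v w | v w. v \<in> component U h \<and> w \<in> component V k}"
    have Wg: "submodule (component W g) K W" by (rule graded_spaceD(2)[OF W g])
    \<comment> \<open>A pair in \<open>?I\<close> has product \<open>g\<close>, so the degree
      hypothesis puts the images of all generators into one and the same component of
      \<open>W\<close>.\<close>
    have S: "?S i \<subseteq> carrier X" "f ` ?S i \<subseteq> component W g" if "i \<in> ?I" for i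
      using that graded_tensor_closed[OF X] graded_spaceD(3)[OF U] graded_spaceD(3)[OF V] deg
      by auto
    have "internal_direct_sum K X ?I (\<lambda>(h, k). vspan K X (?S (h, k))) (component X g)"
      using X g by (auto simp: graded_tensor_def)
    then have "(\<forall>i\<in>?I. submodule (vspan K X (?S i)) K X)"
      and "component X g = (\<lambda>y. \<Oplus>\<^bsub>X\<^esub>i\<in>?I. y i) ` (\<Pi>\<^sub>E i\<in>?I. vspan K X (?S i))"
      by (auto simp: internal_direct_sum_def bij_betw_def case_prod_unfold)
    with x obtain y where y: "y \<in> (\<Pi>\<^sub>E i\<in>?I. vspan K X (?S i))"
      and xy: "x = (\<Oplus>\<^bsub>X\<^esub>i\<in>?I. y i)"
      by blast
    have "y \<in> ?I \<rightarrow> carrier X"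
    proof
      fix i assume i: "i \<in> ?I"
      then have "submodule (vspan K X (?S i)) K X"
        using \<open>\<forall>i\<in>?I. submodule (vspan K X (?S i)) K X\<close> by blast
      then show "y i \<in> carrier X"
        using PiE_mem[OF y i] by (auto simp: submodule_iff[OF X'])
    qed
    then have "f x = (\<Oplus>\<^bsub>W\<^esub>i\<in>?I. f (y i))"
      unfolding xy by (rule lin_finsum[OF X' graded_spaceD(1)[OF W] f])
    also have "\<dots> \<in> component W g"
    proof (intro submodule_finsum[OF graded_spaceD(1)[OF W] Wg] Pi_I)
      fix i assume i: "i \<in> ?I"
      show "f (y i) \<in> component W g"
        using lin_image_vspan[OF X' graded_spaceD(1)[OF W] f Wg S[OF i]] PiE_mem[OF y i] by blast
    qed
    finally show ?thesis .
  qed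
  then show ?thesis using f by (auto simp: ghom_def)
qed

lemma curry_hom_ghom:
  assumes X: "graded_tensor G K U V X t" and G: "group G" "finite (carrier G)"
    and U: "graded_space G K U" and V: "graded_space G K V" and W: "graded_space G K W"
    and f: "f \<in> ghom G K X W"
  shows "curry_hom U V t f \<in> ghom G K U (ihom G K V W)"
proof -
  note tc = graded_tensor_closed[OF X]
  have t: "bilinear_map K U V X t"
    using X by (simp add: graded_tensor_def is_tensor_product_def)
  note fD = linD[OF ghomD(1)[OF f]]
  interpret U: module K U by (rule graded_spaceD(1)[OF U])
  interpret V: module K V by (rule graded_spaceD(1)[OF V])
  have lin: "(\<lambda>v\<in>carrier V. f (t u v)) \<in> lin K V W" if "u \<in> carrier U" for u
    using t that by (intro linI) (auto simp: fD tc bilinear_map_def)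
  show ?thesis
  proof (rule ghom_ihomI[OF U G V W])
    show "curry_hom U V t f \<in> lin K U (lin_space K V W)"
      using lin t by (intro linI) (auto simp: curry_hom_def fD tc bilinear_map_def intro!: restrict_ext)
  next
    fix g u assume g: "g \<in> carrier G" and u: "u \<in> component U g"
    interpret G: group G by (rule G)
    have "f (t u v) \<in> component W (g \<otimes>\<^bsub>G\<^esub> h)" if "h \<in> carrier G" "v \<in> component V h" for h v
      using graded_tensor_component[OF X G(1) U V g u that] ghomD(2)[OF f] g that by simp
    then show "curry_hom U V t f u \<in> hom_deg G K g V W"
      using lin graded_spaceD(3)[OF U g u] graded_spaceD(3)[OF V]
      by (auto simp: curry_hom_def hom_deg_def)
  qed
qed

text \<open>The two halves of the universal property give the two halves of bijectivity: uniqueness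
  of the induced linear map gives injectivity, existence gives surjectivity. The spaces
  \<open>X\<close> and \<open>W\<close> share a carrier type so that \<open>W\<close> is an
  admissible test space.\<close>

lemma bij_betw_curry_hom:
  fixes X :: "('k, 'c, 'g) graded" and W :: "('k, 'c, 'g) graded"
  assumes X: "graded_tensor G K U V X t" and G: "group G" "finite (carrier G)"
    and U: "graded_space G K U" and V: "graded_space G K V" and W: "graded_space G K W"
  shows "bij_betw (curry_hom U V t) (ghom G K X W) (ghom G K U (ihom G K V W))"
proof -
  have tens: "is_tensor_product K U V X t" using X by (simp add: graded_tensor_def)
  note ex1 = tensor_product_ex1[OF tens graded_spaceD(1)[OF W]]
  have b: "bilinear_map K U V W \<psi>" and \<psi>l: "\<And>u. u \<in> carrier U \<Longrightarrow> \<psi> u \<in> lin K V W"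
    if "\<psi> \<in> ghom G K U (ihom G K V W)" for \<psi>
  proof -
    have \<psi>: "\<psi> \<in> lin K U (lin_space K V W)"
      using ghomD(1)[OF that] by (simp add: lin_ihom_iff[OF G V W])
    show \<psi>l: "\<psi> u \<in> lin K V W" if "u \<in> carrier U" for u
      using linD(1)[OF \<psi> that] by simp
    show "bilinear_map K U V W \<psi>"
      using \<psi>l[THEN linD(1)] \<psi>l[THEN linD(2)] \<psi>l[THEN linD(3)] linD[OF \<psi>]
      by (auto simp: bilinear_map_def)
  qed
  show ?thesis
    unfolding bij_betw_def
  proof (intro conjI inj_onI subset_antisym image_subsetI subsetI)
    fix f f' assume f: "f \<in> ghom G K X W" and f': "f' \<in> ghom G K X W"
      and eq: "curry_hom U V t f = curry_hom U V t f'"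
    have 1: "curry_hom U V t f' u v = f' (t u v)" "curry_hom U V t f u v = f (t u v)"
      if "u \<in> carrier U" "v \<in> carrier V" for u v
      using that by (auto simp: curry_hom_def)
    \<comment> \<open>Both \<open>f\<close> and \<open>f'\<close> are linear maps inducing the same
      bilinear map, namely the curried form of \<open>f'\<close>.\<close>
    let ?P = "\<lambda>h. h \<in> lin K X W \<and>
      (\<forall>u\<in>carrier U. \<forall>v\<in>carrier V. h (t u v) = curry_hom U V t f' u v)"
    have "?P f" "?P f'" using f f' 1 eq by (auto simp: ghom_def)
    moreover have "\<exists>!h. ?P h" by (rule ex1[OF b[OF curry_hom_ghom[OF X G U V W f']]])
    ultimately show "f = f'" by blast
  next
    fix f assume "f \<in> ghom G K X W"
    then show "curry_hom U V t f \<in> ghom G K U (ihom G K V W)"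
      by (rule curry_hom_ghom[OF X G U V W])
  next
    fix \<psi> assume \<psi>: "\<psi> \<in> ghom G K U (ihom G K V W)"
    obtain f where f: "f \<in> lin K X W"
      and ft: "\<And>u v. \<lbrakk>u \<in> carrier U; v \<in> carrier V\<rbrakk> \<Longrightarrow> f (t u v) = \<psi> u v"
      using ex1[OF b[OF \<psi>]] by blast
    have "f \<in> ghom G K X W"
    proof (rule graded_tensor_ghomI[OF X G(1) U V W f])
      fix h k u v
      assume h: "h \<in> carrier G" "u \<in> component U h" and k: "k \<in> carrier G" "v \<in> component V k"
      then have "\<psi> u \<in> hom_deg G K h V W" using ghomD(2)[OF \<psi>] by simp
      then have "\<psi> u v \<in> component W (h \<otimes>\<^bsub>G\<^esub> k)" using k by (auto simp: hom_deg_def)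
      then show "f (t u v) \<in> component W (h \<otimes>\<^bsub>G\<^esub> k)"
        using ft graded_spaceD(3)[OF U h] graded_spaceD(3)[OF V k] by simp
    qed
    moreover have "curry_hom U V t f = \<psi>"
    proof (rule lin_ext[OF ghomD(1)[OF curry_hom_ghom[OF X G U V W calculation]] ghomD(1)[OF \<psi>]])
      fix u assume u: "u \<in> carrier U"
      \<comment> \<open>Outside \<open>carrier V\<close> both sides are \<open>undefined\<close>,
        the right one because \<open>\<psi> u\<close> is extensional.\<close>
      then show "curry_hom U V t f u = \<psi> u"
        using ft linD(4)[OF \<psi>l[OF \<psi> u]] by (auto simp: curry_hom_def)
    qed
    ultimately show "\<psi> \<in> curry_hom U V t ` ghom G K X W" by blast
  qed
qed

text \<open>The definite description in \<open>tensor_map\<close> is justified by the universal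
  property, with \<open>T U V\<close> as test space and the bilinear map sending \<open>u\<close>,
  \<open>v\<close> to the pure tensor of \<open>p u\<close> and \<open>q v\<close>.\<close>

lemma tensor_map_pure:
  assumes U: "graded_tensor G K U V (T U V) (t U V)" and U': "graded_tensor G K U' V' (T U' V') (t U' V')"
    and p: "p \<in> lin K U' U" and q: "q \<in> lin K V' V" and u: "u \<in> carrier U'" and v: "v \<in> carrier V'"
  shows "tensor_map K T t U' V' U V p q (t U' V' u v) = t U V (p u) (q v)"
proof -
  have "is_tensor_product K U' V' (T U' V') (t U' V')" "module K (T U V)"
    using U U' by (auto simp: graded_tensor_def is_tensor_product_def)
  moreover have "bilinear_map K U V (T U V) (t U V)"
    using U by (auto simp: graded_tensor_def is_tensor_product_def)
  then have "bilinear_map K U' V' (T U V) (\<lambda>u v. t U V (p u) (q v))"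
    using linD[OF p] linD[OF q] by (auto simp: bilinear_map_def)
  ultimately show ?thesis
    using theI'[OF tensor_product_ex1] u v unfolding tensor_map_def by blast
qed

theorem lemma4p2p3:
  fixes G :: "('g, 'h) monoid_scheme"
    and K :: "('k, 'r) ring_scheme"
    and T :: "('k, 'u, 'g) graded \<Rightarrow> ('k, 'u, 'g) graded \<Rightarrow> ('k, 'u, 'g) graded"
    and t :: "('k, 'u, 'g) graded \<Rightarrow> ('k, 'u, 'g) graded \<Rightarrow> 'u \<Rightarrow> 'u \<Rightarrow> 'u"
    and J :: "('k, 'u, 'g) graded"
    and \<iota> :: "'k \<Rightarrow> 'u"
    and \<alpha> :: "('k, 'u, 'g) graded \<Rightarrow> ('k, 'u, 'g) graded \<Rightarrow> ('k, 'u, 'g) graded \<Rightarrow> 'u \<Rightarrow> 'u"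
  assumes "group G" and "finite (carrier G)"
    and "field K"
    and "graded_monoidal_category G K T t J \<iota> \<alpha>"
  shows
    "(\<forall>(V :: ('k, 'u, 'g) graded) (W :: ('k, 'u, 'g) graded). graded_space G K V \<and> graded_space G K W \<longrightarrow>
        graded_space G K (ihom G K V W)) \<and>
     (\<forall>(V :: ('k, 'u, 'g) graded) (W :: ('k, 'u, 'g) graded)
        (V' :: ('k, 'u, 'g) graded) (W' :: ('k, 'u, 'g) graded) q r.
        graded_space G K V \<and> graded_space G K W \<and> graded_space G K V' \<and> graded_space G K W' \<and>
        q \<in> ghom G K V' V \<and> r \<in> ghom G K W W' \<longrightarrow>
        ihom_map G K V W V' q r \<in> ghom G K (ihom G K V W) (ihom G K V' W')) \<and>
     (\<exists>\<phi> :: ('k, 'u, 'g) graded \<Rightarrow> ('k, 'u, 'g) graded \<Rightarrow> ('k, 'u, 'g) graded \<Rightarrow>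
              ('u \<Rightarrow> 'u) \<Rightarrow> 'u \<Rightarrow> 'u \<Rightarrow> 'u.
        (\<forall>U V W. graded_space G K U \<and> graded_space G K V \<and> graded_space G K W \<longrightarrow>
           bij_betw (\<phi> U V W) (ghom G K (T U V) W) (ghom G K U (ihom G K V W))) \<and>
        (\<forall>U V W U' V' W' p q r f.
           graded_space G K U \<and> graded_space G K V \<and> graded_space G K W \<and>
           graded_space G K U' \<and> graded_space G K V' \<and> graded_space G K W' \<and>
           p \<in> ghom G K U' U \<and> q \<in> ghom G K V' V \<and> r \<in> ghom G K W W' \<and>
           f \<in> ghom G K (T U V) W \<longrightarrow>
           \<phi> U' V' W' (compose (carrier (T U' V')) r
             (compose (carrier (T U' V')) f (tensor_map K T t U' V' U V p q))) =
           compose (carrier U') (ihom_map G K V W V' q r)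
             (compose (carrier U') (\<phi> U V W f) p)) \<and>
        (\<forall>U V W (H :: ('k, 'u, 'g) graded) e.
           graded_space G K U \<and> graded_space G K V \<and> graded_space G K W \<and> graded_space G K H \<and>
           e \<in> giso G K (ihom G K V W) H \<longrightarrow>
           bij_betw (\<lambda>f. compose (carrier U) e (\<phi> U V W f))
             (ghom G K (T U V) W) (ghom G K U H)))"
proof (intro conjI allI impI exI[where x = "\<lambda>U V W. curry_hom U V (t U V)"])
  note G = assms(1,2)
  interpret graded_monoidal_category G K T t J \<iota> \<alpha> by (rule assms(4))
  show "graded_space G K (ihom G K V W)" if "graded_space G K V \<and> graded_space G K W"
    for V W :: "('k, 'u, 'g) graded"
    using that by (intro ihom_graded_space[OF G]) auto
  show "ihom_map G K V W V' q r \<in> ghom G K (ihom G K V W) (ihom G K V' W')"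
    if "graded_space G K V \<and> graded_space G K W \<and> graded_space G K V' \<and> graded_space G K W' \<and>
      q \<in> ghom G K V' V \<and> r \<in> ghom G K W W'"
    for V W V' W' :: "('k, 'u, 'g) graded" and q r
    using that by (intro ihom_map_ghom[OF G]) auto
  show bij: "bij_betw (curry_hom U V (t U V)) (ghom G K (T U V) W) (ghom G K U (ihom G K V W))"
    if "graded_space G K U \<and> graded_space G K V \<and> graded_space G K W"
    for U V and W :: "('k, 'u, 'g) graded"
    using that by (intro bij_betw_curry_hom[OF tensor G]) auto
  show "bij_betw (\<lambda>f. compose (carrier U) e (curry_hom U V (t U V) f))
      (ghom G K (T U V) W) (ghom G K U H)"
    if "graded_space G K U \<and> graded_space G K V \<and> graded_space G K W \<and> graded_space G K H \<and>
      e \<in> giso G K (ihom G K V W) H" for U V and W H :: "('k, 'u, 'g) graded" and e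
  proof -
    have "bij_betw ((\<lambda>f. compose (carrier U) e f) \<circ> curry_hom U V (t U V))
        (ghom G K (T U V) W) (ghom G K U H)"
      using that by (intro bij_betw_trans[OF bij bij_betw_ghom_compose_giso]) auto
    then show ?thesis by (simp add: comp_def)
  qed
  fix U V W U' V' W' :: "('k, 'u, 'g) graded" and p q r f
  assume *: "graded_space G K U \<and> graded_space G K V \<and> graded_space G K W \<and>
    graded_space G K U' \<and> graded_space G K V' \<and> graded_space G K W' \<and>
    p \<in> ghom G K U' U \<and> q \<in> ghom G K V' V \<and> r \<in> ghom G K W W' \<and> f \<in> ghom G K (T U V) W"
  then have X: "graded_tensor G K U V (T U V) (t U V)" and X': "graded_tensor G K U' V' (T U' V') (t U' V')"
    using tensor by auto
  have pq: "p \<in> lin K U' U" "q \<in> lin K V' V" using * by (auto simp: ghom_def)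
  \<comment> \<open>\<open>ihom_map\<close> is \<open>undefined\<close> off the carrier of
    \<open>ihom\<close>, so the curried values have to be placed there before it can be
    evaluated.\<close>
  have "curry_hom U V (t U V) f \<in> ghom G K U (ihom G K V W)"
    using * by (intro curry_hom_ghom[OF X G]) auto
  from linD(1)[OF ghomD(1)[OF this]]
  have "curry_hom U V (t U V) f (p u) \<in> carrier (ihom G K V W)" if "u \<in> carrier U'" for u
    using linD(1)[OF pq(1) that] .
  \<comment> \<open>At \<open>u\<close> in \<open>U'\<close> and \<open>v\<close> in
    \<open>V'\<close> both sides equal \<open>r (f (t U V (p u) (q v)))\<close>.\<close>
  then show "curry_hom U' V' (t U' V') (compose (carrier (T U' V')) r
      (compose (carrier (T U' V')) f (tensor_map K T t U' V' U V p q))) =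
    compose (carrier U') (ihom_map G K V W V' q r)
      (compose (carrier U') (curry_hom U V (t U V) f) p)"
    using linD(1)[OF pq(1)] linD(1)[OF pq(2)]
    by (auto simp: curry_hom_def compose_def ihom_map_def graded_tensor_closed[OF X']
        tensor_map_pure[OF X X' pq] intro!: restrict_ext)
qed

end
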